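(* Let $q$ be an odd prime power. For $k\in\{1,3\}$, the linear set $L_{\psi_8^{(k)}}$ of $\mathrm{PG}(1,q^8)$ is not $\mathrm{P\Gamma L}$-equivalent to the maximum scattered linear set $L^{3,8}_{s,\delta}$, for any $s$ (and any admissible $\delta$).
   Context: $\psi_8(x)=\frac12\bigl(x^{q}+x^{q^{3}}-x^{q^{5}}+x^{q^{7}}\bigr)\in\mathbb{F}_{q^8}[x]$, regarded as an $\mathbb{F}_q$-linear map of $\mathbb{F}_{q^8}$, and $\psi_8^{(k)}$ is its $k$-fold composition with itself. For a $q$-polynomial $f$ (polynomial of the form $\sum_i c_ix^{q^i}$) over $\mathbb{F}_{q^8}$, $L_f=\{\langle (x,f(x))\rangle_{\mathbb{F}_{q^8}}: x\in\mathbb{F}_{q^8}^*\}\subseteq\mathrm{PG}(1,q^8)$; it is maximum scattered if it has $(q^8-1)/(q-1)$ points. $L^{3,8}_{s,\delta}$ denotes $L_f$ with $f(x)=\delta x^{q^s}+x^{q^{s+4}}$, where $\gcd(s,4)=1$, $\delta\in\mathbb{F}_{q^8}$ with $\mathrm{N}_{q^8/q^4}(\delta)=\delta^{q^4+1}\notin\{0,1\}$, and where $\delta$ and $q$ are such that this linear set is maximum scattered (these are the admissible $\delta$). Two linear sets of $\mathrm{PG}(1,q^8)$ are $\mathrm{P\Gamma L}$-equivalent if some element of $\mathrm{P\Gamma L}(2,q^8)$ maps one onto the other. *)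

theory Defs
  imports
    "HOL-Analysis.Analysis"
    "HOL-Number_Theory.Prime_Powers"
begin

(* The field F_(q^8) is modelled by a type 'a of class {field, finite} with CARD('a) = q ^ 8;
   q-polynomials over it are represented by the maps that they induce. *)

definition psi8 :: "nat \<Rightarrow> 'a::field \<Rightarrow> 'a" where
  "psi8 q x = (x ^ q + x ^ (q ^ 3) - x ^ (q ^ 5) + x ^ (q ^ 7)) / 2"

definition f38 :: "nat \<Rightarrow> nat \<Rightarrow> 'a::field \<Rightarrow> 'a \<Rightarrow> 'a" where
  "f38 q s \<delta> x = \<delta> * x ^ (q ^ s) + x ^ (q ^ (s + 4))"

definition PG1 :: "('a::field ^ 2) set set" where
  "PG1 = {vec.span {v} | v. v \<noteq> 0}"

definition linset :: "('a::field \<Rightarrow> 'a) \<Rightarrow> ('a ^ 2) set set" where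
  "linset f = {vec.span {vector [x, f x]} | x. x \<noteq> 0}"

(* The division is exact. *)
definition maximum_scattered :: "nat \<Rightarrow> ('a::field \<Rightarrow> 'a) \<Rightarrow> bool" where
  "maximum_scattered q f \<longleftrightarrow> card (linset f) = (q ^ 8 - 1) div (q - 1)"

(* With CARD('a) = q ^ 8, the exponent q ^ 4 + 1 gives the norm from F_(q^8) to F_(q^4). *)
definition admissible :: "nat \<Rightarrow> nat \<Rightarrow> 'a::field \<Rightarrow> bool" where
  "admissible q s \<delta> \<longleftrightarrow>
     gcd s 4 = 1 \<and> \<delta> ^ (q ^ 4 + 1) \<notin> {0, 1} \<and> maximum_scattered q (f38 q s \<delta>)"

definition field_automorphism :: "('a::field \<Rightarrow> 'a) \<Rightarrow> bool" where
  "field_automorphism \<sigma> \<longleftrightarrow>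
     bij \<sigma> \<and> (\<forall>x y. \<sigma> (x + y) = \<sigma> x + \<sigma> y) \<and> (\<forall>x y. \<sigma> (x * y) = \<sigma> x * \<sigma> y)"

definition GammaL2 :: "('a::field ^ 2 \<Rightarrow> 'a ^ 2) set" where
  "GammaL2 = {\<lambda>v. A *v (\<chi> i. \<sigma> (v $ i)) | A \<sigma>. invertible A \<and> field_automorphism \<sigma>}"

(* Restricting to the points of the projective line identifies semilinear maps that differ
   by a scalar factor, so this is the quotient of GammaL2 by the scalars. *)
definition PGammaL2 :: "(('a::field ^ 2) set \<Rightarrow> ('a ^ 2) set) set" where
  "PGammaL2 = {restrict ((`) g) PG1 | g. g \<in> GammaL2}"

definition PGammaL_equivalent :: "('a::field ^ 2) set set \<Rightarrow> ('a ^ 2) set set \<Rightarrow> bool" where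
  "PGammaL_equivalent L L' \<longleftrightarrow> (\<exists>\<phi>\<in>PGammaL2. \<phi> ` L = L')"

end

theory Submission
  imports Defs
begin

text \<open>
  A point of a linear set \<open>L\<^sub>f\<close> is determined by its slope \<open>f x / x\<close>. Field automorphisms commute with
  \<open>\<Psi> = psi8 q ^^ k\<close>, because its coefficients lie in the prime field, so an equivalence of
  \<open>L\<^sub>\<Psi>\<close> with \<open>L\<^sub>f\<close>, \<open>f = f38 q s \<delta>\<close>, comes down to a matrix: with \<open>h y = a y + b f y\<close> and
  \<open>g y = c y + d f y\<close>, the slopes of \<open>\<Psi>\<close> are the quotients \<open>g y / h y\<close>
  (\<open>PGammaL_equivalent_slopes\<close>). Here \<open>h\<close> has no zero except \<open>0\<close>, hence is bijective, and
  \<open>g \<circ> h\<^sup>-\<^sup>1\<close> is again a \<open>q\<close>-polynomial \<open>G = \<Sum>i<8. B i * x ^ (q ^ i)\<close> (\<open>is_qpoly_right_factor\<close>).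
  So \<open>G\<close> and \<open>\<Psi>\<close> have the same slopes, and \<open>G \<circ> h = g\<close>. These two facts are contradictory.

  Equal slopes restrict \<open>B\<close> (\<open>slopes_coefficients\<close>). They imply equal sums \<open>\<Sum>x. (G x / x) ^ e\<close> over the
  nonzero \<open>x\<close>: every fibre of \<open>x \<mapsto> G x / x\<close> becomes a nontrivial subgroup when \<open>0\<close> is added, so the number of
  its elements is \<open>-1\<close> in the field (\<open>sum_over_slopes\<close>). For \<open>e\<close> equal to \<open>1\<close>, \<open>1 + q\<close>, \<open>1 + q\<^sup>2\<close> and \<open>1 + q + q\<^sup>2\<close> the sums
  are short expressions in the coefficients. Since \<open>psi8 q \<circ> psi8 q\<close> is the map \<open>x \<mapsto> x ^ (q\<^sup>2)\<close> (\<open>psi8_psi8\<close>),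
  \<open>\<Psi>\<close> involves odd powers of Frobenius only, the first and the seventh among them; comparison gives
  \<open>B 0 = B 2 = B 6 = 0\<close> and \<open>B 1 \<noteq> 0 \<noteq> B 7\<close>.

  The coefficients of \<open>G \<circ> h = g\<close> then force \<open>a = b = 0\<close> (\<open>composition_trivial\<close>). As \<open>s\<close> is odd, the
  coefficients with index \<open>s + 2\<close> and \<open>s + 6\<close> combine \<open>a\<close> with odd-indexed and \<open>b\<close> with even-indexed
  entries of \<open>B\<close>, and give \<open>a = 0\<close>. Those with index \<open>2\<close> and \<open>6\<close> form a homogeneous linear system in
  two terms that are multiples of powers of \<open>b\<close>; its determinant is a Frobenius image of \<open>\<delta> ^ (q ^ 4 + 1) - 1 \<noteq> 0\<close>, so
  that \<open>b = 0\<close>.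
\<close>

section \<open>Slopes and sums over them\<close>

definition qpoly :: "nat \<Rightarrow> (nat \<Rightarrow> 'a::field) \<Rightarrow> 'a \<Rightarrow> 'a" where
  "qpoly q c x = (\<Sum>i<8. c i * x ^ (q ^ i))"

definition slopes :: "('a::field \<Rightarrow> 'a) \<Rightarrow> 'a set" where
  "slopes f = {f x / x | x. x \<noteq> 0}"

text \<open>
  Translation by \<open>t\<close> permutes \<open>H\<close> and adds \<open>card H * t\<close> to the sum of its elements.
\<close>

lemma of_nat_card_additive_subgroup:
  fixes H :: "'a::{field, finite} set"
  assumes "t \<in> H" "t \<noteq> 0" and "\<And>x. x \<in> H \<Longrightarrow> x + t \<in> H"
  shows "of_nat (card H) = (0::'a)"
proof -
  have "(\<lambda>x. x + t) ` H = H"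
    by (rule endo_inj_surj) (use assms in auto)
  then have "(\<Sum>x\<in>H. x) = (\<Sum>x\<in>(\<lambda>x. x + t) ` H. x)" by simp
  also have "\<dots> = (\<Sum>x\<in>H. x + t)"
    by (subst sum.reindex) auto
  also have "\<dots> = (\<Sum>x\<in>H. x) + of_nat (card H) * t"
    by (simp add: sum.distrib)
  finally show ?thesis using assms(2) by simp
qed

text \<open>
  The slope \<open>m\<close> is attained on the nonzero elements of the subgroup \<open>{x. G x = m * x}\<close>, whose size
  vanishes in the field. Hence every slope is counted \<open>-1\<close> times, and a sum over \<open>x\<close> of a function
  of \<open>G x / x\<close> depends on the set of slopes alone.
\<close>

lemma sum_over_slopes:
  fixes G F :: "'a::{field, finite} \<Rightarrow> 'a"
  assumes add: "\<And>x y. G (x + y) = G x + G y"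
  shows "(\<Sum>x\<in>-{0}. F (G x / x)) = - (\<Sum>m\<in>slopes G. F m)"
proof -
  have G0: "G 0 = 0" by (metis add add_cancel_left_left)
  have fibre: "of_nat (card {x \<in> -{0}. G x / x = m}) = (-1::'a)" if m: "m \<in> slopes G" for m
  proof -
    let ?H = "{x. G x = m * x}"
    obtain t where t: "t \<noteq> 0" "G t = m * t"
      using m by (auto simp: slopes_def field_simps)
    have "of_nat (card ?H) = (0::'a)"
      by (rule of_nat_card_additive_subgroup[of t]) (use t in \<open>auto simp: add algebra_simps\<close>)
    moreover have "?H = insert 0 {x \<in> -{0}. G x / x = m}"
      by (auto simp: G0 field_simps)
    ultimately show ?thesis
      by (simp add: eq_neg_iff_add_eq_0 add.commute)
  qed
  have "(\<Sum>x\<in>-{0}. F (G x / x)) = (\<Sum>m\<in>slopes G. \<Sum>x\<in>{x \<in> -{0}. G x / x = m}. F (G x / x))"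
    by (rule sum.group[symmetric]) (auto simp: slopes_def)
  also have "\<dots> = (\<Sum>m\<in>slopes G. of_nat (card {x \<in> -{0}. G x / x = m}) * F m)"
    by (intro sum.cong refl) simp
  also have "\<dots> = (\<Sum>m\<in>slopes G. - F m)"
    by (intro sum.cong refl) (simp only: fibre, simp)
  finally show ?thesis by (simp add: sum_negf)
qed

section \<open>Sums of few powers of q\<close>

lemma q_power_le: "3 \<le> q \<Longrightarrow> q ^ i \<le> m \<Longrightarrow> m < q ^ 3 \<Longrightarrow> i < 3" for q i m :: nat
  by (metis le_less_trans less_le_trans not_le one_le_numeral power_increasing order.trans)

text \<open>
  The uniqueness of base-\<open>q\<close> digits, for the few digit patterns that matter below. The hypothesis
  \<open>3 \<le> q\<close> rules out carries such as \<open>q ^ i + q ^ i = q ^ (i + 1)\<close>.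
\<close>

lemma two_q_powers:
  fixes q :: nat
  assumes q: "3 \<le> q" and l: "l \<in> {1, 2}"
  shows "q ^ i + q ^ j = 1 + q ^ l \<longleftrightarrow> i = 0 \<and> j = l \<or> i = l \<and> j = 0"
proof
  assume eq: "q ^ i + q ^ j = 1 + q ^ l"
  define r where "r = q ^ 2"
  have r: "3 * q \<le> r" using q by (simp add: r_def power2_eq_square)
  have cube: "q ^ 3 = q * r" by (simp add: r_def power3_eq_cube power2_eq_square)
  have "3 * r \<le> q ^ 3" using q by (simp add: cube)
  moreover have "q ^ l \<le> r" using l r by (auto simp: r_def)
  ultimately have "1 + q ^ l < q ^ 3" using q r by linarith
  then have "i < 3" "j < 3" using q_power_le[OF q, of _ "1 + q ^ l"] eq by (metis le_add1, metis le_add2)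
  have pow: "m = 0 \<and> q ^ m = 1 \<or> m = 1 \<and> q ^ m = q \<or> m = 2 \<and> q ^ m = r" if "m < 3" for m
  proof -
    have "m = 0 \<or> m = 1 \<or> m = 2" using that by linarith
    then show ?thesis by (elim disjE) (simp_all add: r_def)
  qed
  have "l = 1 \<and> q ^ l = q \<or> l = 2 \<and> q ^ l = r" using l by (auto simp: r_def)
  with pow[OF \<open>i < 3\<close>] pow[OF \<open>j < 3\<close>] show "i = 0 \<and> j = l \<or> i = l \<and> j = 0"
    using eq q r by (elim disjE conjE) (linarith | simp)+
qed auto

lemma three_q_powers:
  fixes q :: nat
  assumes q: "3 \<le> q"
  shows "q ^ i + q ^ j + q ^ k = 1 + q + q ^ 2 \<longleftrightarrow>
    (i, j, k) \<in> {(0,1,2), (0,2,1), (1,0,2), (1,2,0), (2,0,1), (2,1,0)}"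
proof
  assume eq: "q ^ i + q ^ j + q ^ k = 1 + q + q ^ 2"
  define r where "r = q ^ 2"
  have r: "3 * q \<le> r" using q by (simp add: r_def power2_eq_square)
  have cube: "q ^ 3 = q * r" by (simp add: r_def power3_eq_cube power2_eq_square)
  have "3 * r \<le> q ^ 3" using q by (simp add: cube)
  then have "1 + q + q ^ 2 < q ^ 3" using q r by (simp add: r_def)
  moreover have "q ^ i \<le> 1 + q + q ^ 2" "q ^ j \<le> 1 + q + q ^ 2" "q ^ k \<le> 1 + q + q ^ 2"
    using eq by linarith+
  ultimately have "i < 3" "j < 3" "k < 3" using q_power_le[OF q] by blast+
  have pow: "m = 0 \<and> q ^ m = 1 \<or> m = 1 \<and> q ^ m = q \<or> m = 2 \<and> q ^ m = r" if "m < 3" for m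
  proof -
    have "m = 0 \<or> m = 1 \<or> m = 2" using that by linarith
    then show ?thesis by (elim disjE) (simp_all add: r_def)
  qed
  have "q ^ i + q ^ j + q ^ k = 1 + q + r" using eq by (simp only: r_def)
  with pow[OF \<open>i < 3\<close>] pow[OF \<open>j < 3\<close>] pow[OF \<open>k < 3\<close>]
  show "(i, j, k) \<in> {(0,1,2), (0,2,1), (1,0,2), (1,2,0), (2,0,1), (2,1,0)}"
    using q r by (elim disjE conjE) (linarith | simp)+
qed auto

section \<open>Frobenius and power sums in the field with q^8 elements\<close>

lemma sum_lessThan_8: "(\<Sum>i<(8::nat). f i) = f 0 + f 1 + f 2 + f 3 + f 4 + f 5 + f 6 + f 7"
  for f :: "nat \<Rightarrow> 'b::comm_monoid_add"
  by (simp add: eval_nat_numeral)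

text \<open>
  The parameter \<open>field_type\<close> only determines the type \<open>'a\<close>, which does not occur in the type of \<open>q\<close>.
\<close>

locale octic_field =
  fixes q :: nat and field_type :: "'a::{field, finite} itself"
  assumes primepow_q: "primepow q" and odd_q: "odd q" and card_field: "CARD('a) = q ^ 8"
begin

lemma of_nat_card_field: "of_nat (q ^ 8) = (0::'a)"
  using of_nat_card_additive_subgroup[of "1::'a" UNIV] card_field by simp

lemma q_ge_3: "3 \<le> q"
proof -
  have "q > 1" using primepow_q by (simp add: primepow_gt_Suc_0)
  then show ?thesis using odd_q by (cases "q = 2") auto
qed

lemma q_eq_char_power: "prime CHAR('a) \<and> (\<exists>n. q = CHAR('a) ^ n)"
proof -
  obtain p n where p: "prime p" "q = p ^ n" using primepow_q by (auto simp: primepow_def)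
  have pr: "prime CHAR('a)"
    using prime_CHAR_semidom[where ?'a = 'a] finite_imp_CHAR_pos[where ?'a = 'a] by simp
  have "CHAR('a) dvd p ^ (n * 8)"
    using of_nat_card_field p(2) by (simp add: of_nat_eq_0_iff_char_dvd flip: power_mult of_nat_power)
  then have "CHAR('a) = p" using pr p(1)
    by (metis prime_dvd_power primes_dvd_imp_eq)
  then show ?thesis using pr p by auto
qed

lemma q_power_char: "\<exists>n. q ^ i = CHAR('a) ^ n"
  using q_eq_char_power by (metis power_mult)

lemma frobenius_add: "(x + y :: 'a) ^ (q ^ i) = x ^ (q ^ i) + y ^ (q ^ i)"
  using q_power_char[of i] q_eq_char_power freshmans_dream'[where ?'a = 'a] by metis

lemma frobenius_sum: "(sum f A :: 'a) ^ (q ^ i) = (\<Sum>x\<in>A. f x ^ (q ^ i))"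
  using q_power_char[of i] q_eq_char_power freshmans_dream_sum'[where ?'a = 'a] by metis

lemma frobenius_minus: "(- x :: 'a) ^ (q ^ i) = - (x ^ (q ^ i))"
  using odd_q by (simp add: power_minus_odd)

lemma two_neq_0: "(2::'a) \<noteq> 0"
proof
  assume "(2::'a) = 0"
  then have "CHAR('a) dvd 2" by (metis of_nat_numeral of_nat_eq_0_iff_char_dvd)
  then have "CHAR('a) = 2" using q_eq_char_power by (metis primes_dvd_imp_eq two_is_prime_nat)
  then show False using q_eq_char_power odd_q q_ge_3
    by (metis One_nat_def even_power not_gr0 numeral_le_one_iff power_0 semiring_norm(70) dvd_refl)
qed

lemma frobenius_2: "(2::'a) ^ (q ^ i) = 2"
  using frobenius_add[of 1 1 i] by simp

text \<open>
  Multiplication by a nonzero \<open>x\<close> permutes the nonzero elements, so it fixes their product.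
\<close>

lemma power_card_field: "(x :: 'a) ^ (q ^ 8) = x"
proof (cases "x = 0")
  case False
  have "(\<Prod>y\<in>-{0}. x * y) = (\<Prod>y\<in>-{0}. y)"
    by (rule prod.reindex_bij_witness[of _ "\<lambda>y. y / x" "\<lambda>y. x * y"]) (use False in auto)
  moreover have "(\<Prod>y\<in>-{0}. x * y) = x ^ card (-{0::'a}) * (\<Prod>y\<in>-{0}. y)"
    by (simp only: prod.distrib prod_constant)
  moreover have "(\<Prod>y\<in>-{0::'a}. y) \<noteq> 0" by simp
  ultimately have "x ^ card (-{0::'a}) = 1" by simp
  moreover have "q ^ 8 = Suc (card (-{0::'a}))"
    using q_ge_3 by (simp add: Compl_eq_Diff_UNIV card_Diff_subset card_field)
  ultimately show ?thesis by simp
qed (use q_ge_3 in auto)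

lemma frobenius_mod_8: "(x :: 'a) ^ (q ^ m) = x ^ (q ^ (m mod 8))"
proof -
  have iter: "x ^ (q ^ (8 * k)) = x" for k
  proof (induction k)
    case (Suc k)
    have "x ^ (q ^ (8 * Suc k)) = (x ^ (q ^ 8)) ^ (q ^ (8 * k))"
      by (simp add: power_add flip: power_mult)
    then show ?case by (simp add: power_card_field Suc)
  qed simp
  have "x ^ (q ^ m) = x ^ (q ^ (8 * (m div 8) + m mod 8))" by simp
  also have "\<dots> = (x ^ (q ^ (8 * (m div 8)))) ^ (q ^ (m mod 8))"
    by (simp only: power_add power_mult)
  finally show ?thesis by (simp only: iter)
qed

lemma frobenius_inj: "(x :: 'a) ^ (q ^ i) = y ^ (q ^ i) \<longleftrightarrow> x = y"
proof
  assume "x ^ (q ^ i) = y ^ (q ^ i)"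
  then have "(x - y) ^ (q ^ i) = 0"
    using frobenius_add[of x "- y" i] frobenius_minus[of y i] by simp
  then show "x = y" by simp
qed simp

text \<open>
  If \<open>n \<noteq> m\<close>, some nonzero \<open>t\<close> has \<open>t ^ n \<noteq> t ^ m\<close>, since a polynomial of degree less than \<open>q ^ 8 - 1\<close>
  cannot vanish on all nonzero elements; substituting \<open>t * x\<close> for \<open>x\<close> multiplies the sum by
  \<open>t ^ n / t ^ m \<noteq> 1\<close>.
\<close>

lemma power_quotient_sum:
  fixes n m :: nat
  assumes "n < m + (q ^ 8 - 1)" "m < n + (q ^ 8 - 1)"
  shows "(\<Sum>x\<in>-{0}. x ^ n / x ^ m) = (if n = m then - 1 else 0 :: 'a)"
proof -
  have card: "of_nat (card (-{0::'a})) = (-1 :: 'a)" "card (-{0::'a}) = q ^ 8 - 1"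
  proof -
    show c: "card (-{0::'a}) = q ^ 8 - 1"
      by (simp add: Compl_eq_Diff_UNIV card_Diff_subset card_field)
    have "q ^ 8 = Suc (q ^ 8 - 1)" using q_ge_3 by simp
    then have "1 + of_nat (q ^ 8 - 1) = (0::'a)" by (metis of_nat_Suc of_nat_card_field)
    then show "of_nat (card (-{0::'a})) = (-1 :: 'a)"
      unfolding c by (simp add: eq_neg_iff_add_eq_0 add.commute)
  qed
  show ?thesis
  proof (cases "n = m")
    case True
    then have "(\<Sum>x\<in>-{0}. x ^ n / x ^ m) = (\<Sum>x\<in>-{0::'a}. 1 :: 'a)" by (intro sum.cong refl) simp
    also have "\<dots> = of_nat (card (-{0::'a}))" by (simp only: sum_constant mult_1_right)
    finally show ?thesis using True card(1) by simp
  next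
    case False
    have ex: "\<exists>t::'a. t \<noteq> 0 \<and> t ^ d \<noteq> 1" if "0 < d" "d < q ^ 8 - 1" for d
    proof (rule ccontr)
      let ?p = "monom 1 d - 1 :: 'a poly"
      assume "\<not> ?thesis"
      then have "-{0} \<subseteq> {t. poly ?p t = 0}" by (auto simp: poly_monom)
      then have "q ^ 8 - 1 \<le> card {t. poly ?p t = 0}"
        using card(2) by (metis card_mono finite)
      moreover have "coeff ?p d = 1" using that by simp
      then have "?p \<noteq> 0" by (metis coeff_0 zero_neq_one)
      then have "card {t. poly ?p t = 0} \<le> degree ?p" by (rule card_poly_roots_bound)
      moreover have "degree ?p \<le> d" by (intro degree_diff_le) (auto simp: degree_monom_le)
      ultimately show False using that by linarith
    qed
    obtain t :: 'a where t: "t \<noteq> 0" "t ^ n \<noteq> t ^ m"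
    proof (cases "n < m")
      case True
      obtain t :: 'a where "t \<noteq> 0" "t ^ (m - n) \<noteq> 1" using ex[of "m - n"] True assms(2) by (metis less_diff_conv2 add.commute less_imp_le_nat zero_less_diff)
      moreover have "t ^ m = t ^ n * t ^ (m - n)" using True by (simp flip: power_add)
      ultimately show ?thesis using that[of t] by simp
    next
      case F: False
      obtain t :: 'a where "t \<noteq> 0" "t ^ (n - m) \<noteq> 1" using ex[of "n - m"] F False assms(1) by (metis less_diff_conv2 add.commute not_less zero_less_diff le_neq_implies_less)
      moreover have "t ^ n = t ^ m * t ^ (n - m)" using F by (simp flip: power_add)
      ultimately show ?thesis using that[of t] by simp
    qed
    let ?S = "\<Sum>x\<in>-{0}. x ^ n / x ^ m :: 'a"
    have "?S = (\<Sum>x\<in>-{0}. (t * x) ^ n / (t * x) ^ m)"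
      by (rule sum.reindex_bij_witness[of _ "\<lambda>x. t * x" "\<lambda>x. x / t"]) (use t in auto)
    also have "\<dots> = t ^ n / t ^ m * ?S"
      by (simp add: sum_distrib_left power_mult_distrib)
    finally have "(t ^ n / t ^ m - 1) * ?S = 0" by (simp add: algebra_simps)
    then show ?thesis using t False by simp
  qed
qed

lemma q_power_bound: "i < 8 \<Longrightarrow> 3 * q ^ i \<le> q ^ 8"
proof -
  assume "i < 8"
  then have "q ^ i \<le> q ^ 7" using q_ge_3 by (intro power_increasing) auto
  then have "3 * q ^ i \<le> q * q ^ 7" using q_ge_3 by (intro mult_mono) auto
  then show ?thesis by (simp flip: power_Suc)
qed

section \<open>Coefficients of q-polynomials\<close>

lemma monomial_coefficient:
  assumes "k < 8"
  shows "(\<Sum>x\<in>-{0}. u * x ^ (q ^ m) / x ^ (q ^ k)) = (if m mod 8 = k then - u else 0 :: 'a)"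
proof -
  have b: "3 * q ^ (m mod 8) \<le> q ^ 8" "3 * q ^ k \<le> q ^ 8" using q_power_bound assms by auto
  have pos: "q ^ (m mod 8) \<ge> 1" "q ^ k \<ge> 1" using q_ge_3 by auto
  have "(\<Sum>x\<in>-{0}. u * x ^ (q ^ m) / x ^ (q ^ k))
      = u * (\<Sum>x\<in>-{0}. x ^ (q ^ (m mod 8)) / x ^ (q ^ k))"
    unfolding sum_distrib_left by (intro sum.cong refl) (subst frobenius_mod_8[of _ m], simp)
  also have "\<dots> = u * (if q ^ (m mod 8) = q ^ k then - 1 else 0)"
    by (subst power_quotient_sum) (use b pos in auto)
  also have "q ^ (m mod 8) = q ^ k \<longleftrightarrow> m mod 8 = k" using q_ge_3 by simp
  finally show ?thesis by simp
qed

text \<open>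
  By the orthogonality of \<open>power_quotient_sum\<close>, the coefficients can be read off from the values.
\<close>

lemma qpoly_coefficient:
  assumes "k < 8"
  shows "(\<Sum>x\<in>-{0}. qpoly q c x / x ^ (q ^ k)) = - (c k :: 'a)"
proof -
  have "(\<Sum>x\<in>-{0}. qpoly q c x / x ^ (q ^ k))
      = (\<Sum>i<8. \<Sum>x\<in>-{0}. c i * x ^ (q ^ i) / x ^ (q ^ k))"
    unfolding qpoly_def sum_divide_distrib by (rule sum.swap)
  also have "\<dots> = (\<Sum>i<8. if i = k then - c i else 0)"
    using assms by (intro sum.cong refl) (simp add: monomial_coefficient)
  also have "\<dots> = - c k" using assms by simp
  finally show ?thesis .
qed

text \<open>
  Only the monomials with \<open>q ^ i + q ^ j = 1 + q ^ l\<close> survive the summation. The right-hand side is the negative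
  of a \<open>2 \<times> 2\<close> permanent, and that of the next lemma of a \<open>3 \<times> 3\<close> permanent.
\<close>

lemma qpoly_pair_sum:
  assumes l: "l \<in> {1, 2}"
  shows "(\<Sum>x\<in>-{0}. qpoly q u x * qpoly q v x / (x * x ^ (q ^ l))) = - (u 0 * v l + u l * v 0 :: 'a)"
proof -
  let ?I = "{..<8::nat} \<times> {..<8::nat}"
  have 1: "(\<Sum>x\<in>-{0}. u i * v j * (x ^ (q ^ i + q ^ j) / x ^ (1 + q ^ l)))
        = (if (i, j) \<in> {(0, l), (l, 0)} then - (u i * v j) else 0)" if "i < 8" "j < 8" for i j
  proof -
    have b: "3 * q ^ i \<le> q ^ 8" "3 * q ^ j \<le> q ^ 8" "3 * q ^ l \<le> q ^ 8" "3 * q ^ 0 \<le> q ^ 8"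
      using that l by (intro q_power_bound; auto)+
    have pos: "q ^ i \<ge> 1" "q ^ j \<ge> 1" "q ^ l \<ge> 1" using q_ge_3 by auto
    have lt: "q ^ i + q ^ j < 1 + q ^ l + (q ^ 8 - 1)" "1 + q ^ l < q ^ i + q ^ j + (q ^ 8 - 1)"
      using b pos unfolding power_0 by linarith+
    show ?thesis
      unfolding sum_distrib_left[symmetric]
      using two_q_powers[OF q_ge_3 l, of i j] by (subst power_quotient_sum[OF lt]) auto
  qed
  have "(\<Sum>x\<in>-{0}. qpoly q u x * qpoly q v x / (x * x ^ (q ^ l)))
      = (\<Sum>x\<in>-{0}. \<Sum>(i, j)\<in>?I. u i * v j * (x ^ (q ^ i + q ^ j) / x ^ (1 + q ^ l)))"
    unfolding qpoly_def sum_product sum.cartesian_product sum_divide_distrib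
    by (intro sum.cong refl) (auto simp: power_add mult_ac)
  also have "\<dots> = (\<Sum>p\<in>?I. \<Sum>x\<in>-{0}. case p of (i, j) \<Rightarrow> u i * v j * (x ^ (q ^ i + q ^ j) / x ^ (1 + q ^ l)))"
    by (rule sum.swap)
  also have "\<dots> = (\<Sum>p\<in>?I. if p \<in> {(0, l), (l, 0)} then - (u (fst p) * v (snd p)) else 0)"
  proof (intro sum.cong refl)
    fix p assume "p \<in> ?I"
    then obtain i j where "p = (i, j)" "i < 8" "j < 8" by auto
    then show "(\<Sum>x\<in>-{0}. case p of (i, j) \<Rightarrow> u i * v j * (x ^ (q ^ i + q ^ j) / x ^ (1 + q ^ l)))
        = (if p \<in> {(0, l), (l, 0)} then - (u (fst p) * v (snd p)) else 0)"
      using 1[of i j] by (simp only: prod.case fst_conv snd_conv)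
  qed
  also have "\<dots> = (\<Sum>p\<in>?I \<inter> {(0, l), (l, 0)}. - (u (fst p) * v (snd p)))"
    by (rule sum.inter_restrict[symmetric]) simp
  also have "?I \<inter> {(0, l), (l, 0)} = {(0, l), (l, 0)}" using l by auto
  also have "(\<Sum>p\<in>{(0, l), (l, 0)}. - (u (fst p) * v (snd p))) = - (u 0 * v l + u l * v 0)"
    using l by auto
  finally show ?thesis .
qed

lemma qpoly_triple_sum:
  "(\<Sum>x\<in>-{0}. qpoly q u x * qpoly q v x * qpoly q w x / (x * x ^ q * x ^ (q ^ 2)))
     = - (u 0 * v 1 * w 2 + u 0 * v 2 * w 1 + u 1 * v 0 * w 2
        + u 1 * v 2 * w 0 + u 2 * v 0 * w 1 + u 2 * v 1 * w 0 :: 'a)"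
proof -
  let ?I = "{..<8::nat} \<times> {..<8::nat} \<times> {..<8::nat}"
  let ?S = "{(0,1,2), (0,2,1), (1,0,2), (1,2,0), (2,0,1), (2,1,0)} :: (nat \<times> nat \<times> nat) set"
  let ?t = "\<lambda>i j k. u i * v j * w k"
  have 1: "(\<Sum>x\<in>-{0}. ?t i j k * (x ^ (q ^ i + q ^ j + q ^ k) / x ^ (1 + q + q ^ 2)))
        = (if (i, j, k) \<in> ?S then - ?t i j k else 0)" if "i < 8" "j < 8" "k < 8" for i j k
  proof -
    have b: "3 * q ^ i \<le> q ^ 8" "3 * q ^ j \<le> q ^ 8" "3 * q ^ k \<le> q ^ 8"
      "3 * q ^ 0 \<le> q ^ 8" "3 * q ^ 1 \<le> q ^ 8" "3 * q ^ 2 \<le> q ^ 8"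
      using that by (intro q_power_bound; simp)+
    have pos: "q ^ i \<ge> 1" "q ^ j \<ge> 1" "q ^ k \<ge> 1" "q ^ 2 \<ge> 1" using q_ge_3 by auto
    have lt: "q ^ i + q ^ j + q ^ k < 1 + q + q ^ 2 + (q ^ 8 - 1)"
      "1 + q + q ^ 2 < q ^ i + q ^ j + q ^ k + (q ^ 8 - 1)"
      using b pos q_ge_3 unfolding power_0 power_one_right by linarith+
    show ?thesis
      unfolding sum_distrib_left[symmetric]
      using three_q_powers[OF q_ge_3, of i j k] by (subst power_quotient_sum[OF lt]) auto
  qed
  have "(\<Sum>x\<in>-{0}. qpoly q u x * qpoly q v x * qpoly q w x / (x * x ^ q * x ^ (q ^ 2)))
      = (\<Sum>x\<in>-{0}. \<Sum>(i, j, k)\<in>?I. ?t i j k * (x ^ (q ^ i + q ^ j + q ^ k) / x ^ (1 + q + q ^ 2)))"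
  proof (intro sum.cong refl)
    fix x :: 'a
    have "qpoly q u x * qpoly q v x * qpoly q w x = qpoly q u x * (qpoly q v x * qpoly q w x)"
      by (simp add: mult.assoc)
    also have "\<dots> = (\<Sum>(i, j, k)\<in>?I. ?t i j k * x ^ (q ^ i + q ^ j + q ^ k))"
      unfolding qpoly_def sum_product sum.cartesian_product
      by (intro sum.cong refl) (auto simp: power_add mult_ac)
    finally show "qpoly q u x * qpoly q v x * qpoly q w x / (x * x ^ q * x ^ (q ^ 2))
        = (\<Sum>(i, j, k)\<in>?I. ?t i j k * (x ^ (q ^ i + q ^ j + q ^ k) / x ^ (1 + q + q ^ 2)))"
      by (simp add: sum_divide_distrib power_add case_prod_unfold mult.assoc)
  qed
  also have "\<dots> = (\<Sum>p\<in>?I. \<Sum>x\<in>-{0}. case p of (i, j, k) \<Rightarrow>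
      ?t i j k * (x ^ (q ^ i + q ^ j + q ^ k) / x ^ (1 + q + q ^ 2)))"
    by (rule sum.swap)
  also have "\<dots> = (\<Sum>p\<in>?I. if p \<in> ?S then - (case p of (i, j, k) \<Rightarrow> ?t i j k) else 0)"
  proof (intro sum.cong refl)
    fix p assume "p \<in> ?I"
    then obtain i j k where "p = (i, j, k)" "i < 8" "j < 8" "k < 8" by auto
    then show "(\<Sum>x\<in>-{0}. case p of (i, j, k) \<Rightarrow> ?t i j k * (x ^ (q ^ i + q ^ j + q ^ k) / x ^ (1 + q + q ^ 2)))
        = (if p \<in> ?S then - (case p of (i, j, k) \<Rightarrow> ?t i j k) else 0)"
      using 1[of i j k] by (simp only: prod.case)
  qed
  also have "\<dots> = (\<Sum>p\<in>?I \<inter> ?S. - (case p of (i, j, k) \<Rightarrow> ?t i j k))"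
    by (rule sum.inter_restrict[symmetric]) simp
  also have "?I \<inter> ?S = ?S" by auto
  finally show ?thesis by (simp add: algebra_simps)
qed

lemma qpoly_add: "qpoly q c (x + y) = qpoly q c x + (qpoly q c y :: 'a)"
  by (simp add: qpoly_def frobenius_add sum.distrib algebra_simps)

text \<open>
  Raising to the power \<open>q ^ l\<close> shifts the coefficients cyclically by \<open>l\<close>; adding \<open>8 - l\<close> instead of
  subtracting \<open>l\<close> avoids truncated subtraction.
\<close>

lemma qpoly_frobenius:
  assumes "l < 8"
  shows "qpoly q c x ^ (q ^ l) = qpoly q (\<lambda>i. c ((i + (8 - l)) mod 8) ^ (q ^ l)) (x :: 'a)"
proof -
  have "qpoly q c x ^ (q ^ l) = (\<Sum>i<8. c i ^ (q ^ l) * x ^ (q ^ ((i + l) mod 8)))"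
    unfolding qpoly_def frobenius_sum
    by (intro sum.cong refl)
      (simp add: power_mult_distrib frobenius_mod_8[symmetric] power_add power_mult)
  also have "\<dots> = (\<Sum>i<8. c ((i + (8 - l)) mod 8) ^ (q ^ l) * x ^ (q ^ i))"
  proof (rule sum.reindex_bij_witness[of _ "\<lambda>i. (i + (8 - l)) mod 8" "\<lambda>i. (i + l) mod 8"])
    fix i assume "i \<in> {..<8::nat}"
    then show "((i + l) mod 8 + (8 - l)) mod 8 = i" "((i + (8 - l)) mod 8 + l) mod 8 = i"
    proof -
      assume "i \<in> {..<8::nat}"
      moreover have "i + l + (8 - l) = i + 8" "i + (8 - l) + l = i + 8" using assms by linarith+
      ultimately show "((i + l) mod 8 + (8 - l)) mod 8 = i" "((i + (8 - l)) mod 8 + l) mod 8 = i"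
        by (simp_all only: mod_add_left_eq) simp_all
    qed
    then show "c (((i + l) mod 8 + (8 - l)) mod 8) ^ q ^ l * x ^ q ^ ((i + l) mod 8)
        = c i ^ q ^ l * x ^ q ^ ((i + l) mod 8)" by simp
  qed auto
  finally show ?thesis by (simp add: qpoly_def)
qed

lemma slopes_power_sum_eq:
  assumes "slopes (qpoly q b) = slopes (qpoly q c :: 'a \<Rightarrow> 'a)"
  shows "(\<Sum>x\<in>-{0}. F (qpoly q b x / x)) = (\<Sum>x\<in>-{0}. F (qpoly q c x / x) :: 'a)"
  using assms by (simp add: sum_over_slopes qpoly_add)

text \<open>
  Power sums of the slopes with exponents \<open>1\<close>, \<open>1 + q\<close> and \<open>1 + q\<^sup>2\<close> yield \<open>b 0 = 0\<close>, \<open>b 1 * b 7 ^ q \<noteq> 0\<close> and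
  \<open>b 2 * b 6 ^ (q\<^sup>2) = 0\<close>. The exponent \<open>1 + q + q\<^sup>2\<close> involves three indices with sum divisible by \<open>8\<close>,
  namely \<open>1, 1, 6\<close> and \<open>2, 7, 7\<close>; it shows that \<open>b 2\<close> and \<open>b 6\<close> vanish together.
\<close>

lemma slopes_coefficients:
  assumes eq: "slopes (qpoly q b) = slopes (qpoly q c :: 'a \<Rightarrow> 'a)"
    and c: "c 0 = 0" "c 2 = 0" "c 6 = 0" "c 1 \<noteq> 0" "c 7 \<noteq> 0"
  shows "b 0 = 0 \<and> b 2 = 0 \<and> b 6 = 0 \<and> b 1 \<noteq> 0 \<and> b 7 \<noteq> 0"
proof -
  note S = slopes_power_sum_eq[OF eq]
  have b0: "b 0 = 0"
    using S[of "\<lambda>m. m"] c qpoly_coefficient[of 0 b] qpoly_coefficient[of 0 c] by simp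
  \<comment> \<open>Frobenius images of \<open>qpoly q a\<close> are \<open>q\<close>-polynomials, so the power sums are sums of products of these.\<close>
  have pair: "(\<Sum>x\<in>-{0}. (qpoly q a x / x) * (qpoly q a x / x) ^ (q ^ l))
      = - (a 0 * a 0 ^ q ^ l + a l * a (8 - l) ^ (q ^ l))" if "l \<in> {1, 2}" for a :: "nat \<Rightarrow> 'a" and l
  proof -
    have l: "l < 8" using that by auto
    have "(\<Sum>x\<in>-{0}. (qpoly q a x / x) * (qpoly q a x / x) ^ (q ^ l))
        = (\<Sum>x\<in>-{0}. qpoly q a x * qpoly q (\<lambda>i. a ((i + (8 - l)) mod 8) ^ (q ^ l)) x / (x * x ^ (q ^ l)))"
      by (intro sum.cong refl) (simp add: power_divide qpoly_frobenius[OF l])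
    then show ?thesis using qpoly_pair_sum[OF that] that by auto
  qed
  have trip: "(\<Sum>x\<in>-{0}. (qpoly q a x / x) * (qpoly q a x / x) ^ q * (qpoly q a x / x) ^ (q ^ 2))
      = - (a 1 * a 1 ^ q * a 6 ^ (q ^ 2) + a 2 * a 7 ^ q * a 7 ^ (q ^ 2))"
    if "a 0 = 0" for a :: "nat \<Rightarrow> 'a"
  proof -
    have "(\<Sum>x\<in>-{0}. (qpoly q a x / x) * (qpoly q a x / x) ^ q * (qpoly q a x / x) ^ (q ^ 2))
      = (\<Sum>x\<in>-{0}. qpoly q a x * qpoly q (\<lambda>i. a ((i + 7) mod 8) ^ q) x
           * qpoly q (\<lambda>i. a ((i + 6) mod 8) ^ (q ^ 2)) x / (x * x ^ q * x ^ (q ^ 2)))"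
      using qpoly_frobenius[of 1 a] qpoly_frobenius[of 2 a]
      by (intro sum.cong refl) (simp add: power_divide)
    moreover have "0 < q" using q_ge_3 by simp
    ultimately show ?thesis using that by (simp add: qpoly_triple_sum power_0_left)
  qed
  have q0: "q \<noteq> 0" using q_ge_3 by simp
  have "b 1 * b 7 ^ q = c 1 * c 7 ^ q"
    using S[of "\<lambda>m. m * m ^ (q ^ 1)"] pair[of 1 b] pair[of 1 c] b0 c q0 by simp
  moreover have "c 1 * c 7 ^ q \<noteq> 0" using c by simp
  ultimately have b17: "b 1 \<noteq> 0" "b 7 \<noteq> 0" using q0 by (auto simp: power_0_left)
  have "b 2 * b 6 ^ (q ^ 2) = 0"
    using S[of "\<lambda>m. m * m ^ (q ^ 2)"] pair[of 2 b] pair[of 2 c] b0 c q0 by simp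
  then have b26: "b 2 = 0 \<or> b 6 = 0" by auto
  have "- (b 1 * b 1 ^ q * b 6 ^ (q ^ 2) + b 2 * b 7 ^ q * b 7 ^ (q ^ 2))
      = - (c 1 * c 1 ^ q * c 6 ^ (q ^ 2) + c 2 * c 7 ^ q * c 7 ^ (q ^ 2))"
    using S[of "\<lambda>m. m * m ^ q * m ^ (q ^ 2)"] unfolding trip[of b, OF b0] trip[of c, OF c(1)] .
  with b26 b17 q0 c have "b 2 = 0 \<and> b 6 = 0" by (auto simp: power_0_left)
  with b0 b17 show ?thesis by simp
qed

section \<open>Composition of q-polynomials\<close>

definition is_qpoly :: "('a \<Rightarrow> 'a) \<Rightarrow> bool" where
  "is_qpoly f \<longleftrightarrow> (\<exists>c. f = qpoly q c)"

lemma is_qpoly_monomial: "is_qpoly (\<lambda>x. u * x ^ (q ^ m))"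
  unfolding is_qpoly_def
proof (intro exI ext)
  fix x :: 'a
  have "qpoly q (\<lambda>i. if i = m mod 8 then u else 0) x = (\<Sum>i<8. if i = m mod 8 then u * x ^ (q ^ i) else 0)"
    unfolding qpoly_def by (intro sum.cong) auto
  then show "u * x ^ (q ^ m) = qpoly q (\<lambda>i. if i = m mod 8 then u else 0) x"
    by (simp add: frobenius_mod_8[of x m])
qed

lemma is_qpoly_add: "is_qpoly f \<Longrightarrow> is_qpoly g \<Longrightarrow> is_qpoly (\<lambda>x. f x + g x)"
proof -
  assume "is_qpoly f" "is_qpoly g"
  then obtain c d where "f = qpoly q c" "g = qpoly q d" by (auto simp: is_qpoly_def)
  then have "(\<lambda>x. f x + g x) = qpoly q (\<lambda>i. c i + d i)"
    by (auto simp: qpoly_def sum.distrib algebra_simps)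
  then show ?thesis by (auto simp: is_qpoly_def)
qed

lemma is_qpoly_sum:
  assumes "finite A" "\<And>i. i \<in> A \<Longrightarrow> is_qpoly (f i)"
  shows "is_qpoly (\<lambda>x. \<Sum>i\<in>A. f i x)"
  using assms
proof (induction A)
  case empty
  show ?case using is_qpoly_monomial[of 0] by simp
next
  case (insert i A)
  then show ?case by (simp add: is_qpoly_add)
qed

lemma is_qpoly_compose:
  assumes "is_qpoly f" "is_qpoly g"
  shows "is_qpoly (f \<circ> g)"
proof -
  obtain c d where cd: "f = qpoly q c" "g = qpoly q d" using assms by (auto simp: is_qpoly_def)
  have 1: "f \<circ> g = (\<lambda>x. \<Sum>i<8. \<Sum>j<8. (c i * d j ^ (q ^ i)) * x ^ (q ^ (j + i)))"
    unfolding cd by (intro ext)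
      (simp add: qpoly_def frobenius_sum sum_distrib_left power_mult_distrib power_add power_mult mult.assoc)
  show ?thesis unfolding 1 by (intro is_qpoly_sum is_qpoly_monomial) auto
qed

lemma is_qpoly_surj:
  assumes h: "is_qpoly h" "\<And>x. x \<noteq> 0 \<Longrightarrow> h x \<noteq> 0"
  shows "surj h"
proof -
  obtain d where d: "h = qpoly q d" using h by (auto simp: is_qpoly_def)
  have "inj h"
  proof (rule injI)
    fix x y assume "h x = h y"
    moreover have "h x = h (x - y) + h y" using qpoly_add[of d "x - y" y] by (simp add: d)
    ultimately show "x = y" using h(2)[of "x - y"] by auto
  qed
  then show ?thesis by (simp add: finite_UNIV_inj_surj)
qed

text \<open>
  Composition with \<open>h\<close> on the right is an injective map of the finite set of \<open>q\<close>-polynomials to itself,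
  hence surjective. The preimage of \<open>g\<close> is \<open>g \<circ> h\<^sup>-\<^sup>1\<close>.
\<close>

lemma is_qpoly_right_factor:
  assumes h: "is_qpoly h" "surj h" and g: "is_qpoly g"
  shows "\<exists>b. g = qpoly q b \<circ> h"
proof -
  have "(\<lambda>F. F \<circ> h) ` Collect is_qpoly = Collect is_qpoly"
  proof (rule endo_inj_surj)
    show "(\<lambda>F. F \<circ> h) ` Collect is_qpoly \<subseteq> Collect is_qpoly"
      using is_qpoly_compose h(1) by auto
    show "inj_on (\<lambda>F. F \<circ> h) (Collect is_qpoly)"
      using h(2) by (intro inj_onI) (metis comp_assoc comp_id surj_iff)
  qed simp
  then show ?thesis using g unfolding is_qpoly_def by blast
qed

text \<open>
  Division by \<open>x ^ (q ^ k)\<close> and summation over the nonzero \<open>x\<close> isolates the terms whose Frobenius exponent is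
  congruent to \<open>k\<close> modulo \<open>8\<close>, by \<open>monomial_coefficient\<close>.
\<close>

lemma composition_coefficients:
  assumes eq: "\<And>x. qpoly q B (a * x + b * f38 q s \<delta> x) = c * x + d * f38 q s \<delta> (x::'a)"
    and k: "k < 8"
  shows "(\<Sum>i<8. (if i = k then B i * a ^ (q ^ i) else 0)
        + (if (i + s) mod 8 = k then B i * (b * \<delta>) ^ (q ^ i) else 0)
        + (if (i + (s + 4)) mod 8 = k then B i * b ^ (q ^ i) else 0))
      = (if k = 0 then c else 0) + (if s mod 8 = k then d * \<delta> else 0) + (if (s + 4) mod 8 = k then d else 0)"
    (is "?L = ?R")
proof -
  have l: "qpoly q B (a * x + b * f38 q s \<delta> x)
      = (\<Sum>i<8. (B i * a ^ (q ^ i)) * x ^ (q ^ i) + (B i * (b * \<delta>) ^ (q ^ i)) * x ^ (q ^ (i + s))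
          + (B i * b ^ (q ^ i)) * x ^ (q ^ (i + (s + 4))))" for x
  proof -
    have p: "(y ^ q ^ m) ^ q ^ i = y ^ q ^ (i + m)" for y :: 'a and m i
      by (simp only: power_mult[symmetric] power_add[symmetric] add.commute)
    show ?thesis unfolding qpoly_def f38_def
      by (intro sum.cong refl)
        (simp add: distrib_left frobenius_add power_mult_distrib p mult.assoc add.assoc)
  qed
  have r: "c * x + d * f38 q s \<delta> x = c * x ^ (q ^ 0) + (d * \<delta>) * x ^ (q ^ s) + d * x ^ (q ^ (s + 4))" for x
    by (simp add: f38_def algebra_simps)
  have "(\<Sum>x\<in>-{0}. qpoly q B (a * x + b * f38 q s \<delta> x) / x ^ (q ^ k))
      = (\<Sum>i<8. (\<Sum>x\<in>-{0}. (B i * a ^ (q ^ i)) * x ^ (q ^ i) / x ^ (q ^ k))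
          + (\<Sum>x\<in>-{0}. (B i * (b * \<delta>) ^ (q ^ i)) * x ^ (q ^ (i + s)) / x ^ (q ^ k))
          + (\<Sum>x\<in>-{0}. (B i * b ^ (q ^ i)) * x ^ (q ^ (i + (s + 4))) / x ^ (q ^ k)))"
    unfolding l sum_divide_distrib add_divide_distrib
    by (subst sum.swap) (simp only: sum.distrib)
  also have "\<dots> = (\<Sum>i<8. - ((if i = k then B i * a ^ (q ^ i) else 0)
        + (if (i + s) mod 8 = k then B i * (b * \<delta>) ^ (q ^ i) else 0)
        + (if (i + (s + 4)) mod 8 = k then B i * b ^ (q ^ i) else 0)))"
    unfolding monomial_coefficient[OF k] by (intro sum.cong refl) auto
  also have "\<dots> = - ?L" by (rule sum_negf)
  finally have "- ?L = (\<Sum>x\<in>-{0}. qpoly q B (a * x + b * f38 q s \<delta> x) / x ^ (q ^ k))" ..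
  also have "\<dots> = - ?R"
    unfolding eq r sum.distrib add_divide_distrib monomial_coefficient[OF k] by auto
  finally show ?thesis by (rule neg_equal_iff_equal[THEN iffD1])
qed

text \<open>
  The determinant \<open>\<delta> ^ (q ^ i + q ^ j) - 1\<close> of the system is a Frobenius image of \<open>\<delta> ^ (q ^ 4 + 1) - 1\<close>.
\<close>

lemma norm_neq_1_system:
  assumes N: "\<delta> ^ (q ^ 4 + 1) \<noteq> (1::'a)"
    and eqs: "X * \<delta> ^ (q ^ i) + Y = 0" "Y * \<delta> ^ (q ^ j) + X = 0"
    and ij: "j = i + 4 \<or> i = j + 4"
  shows "X = 0 \<and> Y = 0"
proof -
  have norm: "\<delta> ^ (q ^ m) * \<delta> ^ (q ^ (m + 4)) = (\<delta> ^ (q ^ 4 + 1)) ^ (q ^ m)" for m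
    by (simp only: power_mult[symmetric] power_add[symmetric]) (simp add: distrib_left add.commute flip: power_add)
  have "(\<delta> ^ (q ^ 4 + 1)) ^ (q ^ m) \<noteq> 1" for m
    using N frobenius_inj[of "\<delta> ^ (q ^ 4 + 1)" m 1] by simp
  then have "\<delta> ^ (q ^ m) * \<delta> ^ (q ^ (m + 4)) \<noteq> 1" for m by (simp only: norm not_False_eq_True)
  then have D: "\<delta> ^ (q ^ i) * \<delta> ^ (q ^ j) \<noteq> 1"
    using ij by (metis mult.commute)
  have Y: "Y = - (X * \<delta> ^ (q ^ i))" using eqs(1) by (simp add: eq_neg_iff_add_eq_0 add.commute)
  then have "X * (1 - \<delta> ^ (q ^ i) * \<delta> ^ (q ^ j)) = 0" using eqs(2) by (simp add: algebra_simps)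
  then show ?thesis using D Y by auto
qed

lemma f38_mod_8: "f38 q s \<delta> = (f38 q (s mod 8) \<delta> :: 'a \<Rightarrow> 'a)"
proof
  fix x :: 'a
  show "f38 q s \<delta> x = f38 q (s mod 8) \<delta> x"
    unfolding f38_def
    by (subst (1 2 4) frobenius_mod_8) (simp add: mod_simps)
qed

text \<open>
  The four cases are the odd residues of \<open>s\<close> modulo \<open>8\<close>. In each of them the index \<open>1\<close> or \<open>7\<close> is
  congruent to \<open>s + 2\<close> or \<open>s + 6\<close>; there, \<open>b\<close> is multiplied by \<open>B 2\<close> and \<open>B 6\<close>, which vanish, so that \<open>a = 0\<close>.
  In the equations with index \<open>2\<close> and \<open>6\<close>, \<open>a\<close> is multiplied by \<open>B 2\<close> and \<open>B 6\<close>, and \<open>b\<close> by two entries of \<open>B\<close>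
  whose indices differ by \<open>4\<close>; one of these is \<open>B 1\<close> or \<open>B 7\<close>.
\<close>

lemma composition_trivial:
  assumes eq: "\<And>x. qpoly q B (a * x + b * f38 q s \<delta> x) = c * x + d * f38 q s \<delta> (x::'a)"
    and s: "odd s" and N: "\<delta> ^ (q ^ 4 + 1) \<noteq> 1"
    and B: "B 0 = 0" "B 2 = 0" "B 6 = 0" "B 1 \<noteq> 0" "B 7 \<noteq> 0"
  shows "a = 0 \<and> b = 0"
proof -
  define r where "r = s mod 8"
  have "odd r" "r < 8" using s by (auto simp: r_def dvd_mod_iff)
  then have "r = 1 \<or> r = 3 \<or> r = 5 \<or> r = 7" by presburger
  note C = composition_coefficients[OF eq[unfolded f38_mod_8[of s] r_def[symmetric]], unfolded sum_lessThan_8]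
  have q0: "q \<noteq> 0" using q_ge_3 by simp
  from \<open>r = 1 \<or> r = 3 \<or> r = 5 \<or> r = 7\<close> show ?thesis
  proof (elim disjE)
    assume r: "r = 1"
    have A: "B 7 * a ^ (q ^ 7) = 0" using C[of 7] B by (simp add: r)
    have E2: "B 1 * b ^ (q ^ 1) * \<delta> ^ (q ^ 1) + B 5 * b ^ (q ^ 5) = 0"
      using C[of 2] B by (simp add: r power_mult_distrib mult.assoc)
    have E6: "B 5 * b ^ (q ^ 5) * \<delta> ^ (q ^ 5) + B 1 * b ^ (q ^ 1) = 0"
      using C[of 6] B by (simp add: r power_mult_distrib mult.assoc add.commute)
    show ?thesis using A norm_neq_1_system[OF N E2 E6] B by simp
  next
    assume r: "r = 3"
    have A: "B 1 * a ^ (q ^ 1) = 0" using C[of 1] B by (simp add: r)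
    have E2: "B 7 * b ^ (q ^ 7) * \<delta> ^ (q ^ 7) + B 3 * b ^ (q ^ 3) = 0"
      using C[of 2] B by (simp add: r power_mult_distrib mult.assoc add.commute)
    have E6: "B 3 * b ^ (q ^ 3) * \<delta> ^ (q ^ 3) + B 7 * b ^ (q ^ 7) = 0"
      using C[of 6] B by (simp add: r power_mult_distrib mult.assoc add.commute)
    show ?thesis using A norm_neq_1_system[OF N E2 E6] B by simp
  next
    assume r: "r = 5"
    have A: "B 7 * a ^ (q ^ 7) = 0" using C[of 7] B by (simp add: r)
    have E2: "B 5 * b ^ (q ^ 5) * \<delta> ^ (q ^ 5) + B 1 * b ^ (q ^ 1) = 0"
      using C[of 2] B by (simp add: r power_mult_distrib mult.assoc add.commute)
    have E6: "B 1 * b ^ (q ^ 1) * \<delta> ^ (q ^ 1) + B 5 * b ^ (q ^ 5) = 0"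
      using C[of 6] B by (simp add: r power_mult_distrib mult.assoc add.commute)
    show ?thesis using A norm_neq_1_system[OF N E2 E6] B by simp
  next
    assume r: "r = 7"
    have A: "B 1 * a ^ (q ^ 1) = 0" using C[of 1] B by (simp add: r)
    have E2: "B 3 * b ^ (q ^ 3) * \<delta> ^ (q ^ 3) + B 7 * b ^ (q ^ 7) = 0"
      using C[of 2] B by (simp add: r power_mult_distrib mult.assoc add.commute)
    have E6: "B 7 * b ^ (q ^ 7) * \<delta> ^ (q ^ 7) + B 3 * b ^ (q ^ 3) = 0"
      using C[of 6] B by (simp add: r power_mult_distrib mult.assoc add.commute)
    show ?thesis using A norm_neq_1_system[OF N E2 E6] B by simp
  qed
qed

text \<open>
  The right-hand side is the image of the slopes of \<open>f38 q s \<delta>\<close> under a fractional linear map. If it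
  were the left-hand side, it would be the set of slopes of a \<open>q\<close>-polynomial with coefficients \<open>B\<close>, to which
  both \<open>slopes_coefficients\<close> and \<open>composition_trivial\<close> apply.
\<close>

lemma slopes_not_projectively_f38:
  assumes c: "c 0 = 0" "c 2 = 0" "c 6 = 0" "c 1 \<noteq> 0" "c 7 \<noteq> 0"
    and s: "odd s" and N: "\<delta> ^ (q ^ 4 + 1) \<noteq> (1 :: 'a)"
    and nz: "\<And>y. y \<noteq> 0 \<Longrightarrow> u * y + v * f38 q s \<delta> y \<noteq> 0"
  shows "slopes (qpoly q c) \<noteq> {(w * y + z * f38 q s \<delta> y) / (u * y + v * f38 q s \<delta> y) | y. y \<noteq> 0}"
proof
  assume eq: "slopes (qpoly q c) = {(w * y + z * f38 q s \<delta> y) / (u * y + v * f38 q s \<delta> y) | y. y \<noteq> 0}"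
  have lin: "is_qpoly (\<lambda>y. u * y + v * f38 q s \<delta> y)" for u v
  proof -
    have "(\<lambda>y. u * y + v * f38 q s \<delta> y)
        = (\<lambda>y. u * y ^ (q ^ 0) + ((v * \<delta>) * y ^ (q ^ s) + v * y ^ (q ^ (s + 4))))"
      by (simp add: f38_def algebra_simps)
    moreover have "is_qpoly \<dots>" by (intro is_qpoly_add is_qpoly_monomial)
    ultimately show ?thesis by simp
  qed
  define h where "h = (\<lambda>y. u * y + v * f38 q s \<delta> y)"
  define g where "g = (\<lambda>y. w * y + z * f38 q s \<delta> y)"
  have h_nz: "h y \<noteq> 0" if "y \<noteq> 0" for y using nz[OF that] by (simp add: h_def)
  have hg: "is_qpoly h" "is_qpoly g" unfolding h_def g_def by (rule lin)+
  have surj: "surj h" using is_qpoly_surj[OF hg(1) h_nz] .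
  obtain B where gB: "g = qpoly q B \<circ> h"
    using is_qpoly_right_factor[OF hg(1) surj hg(2)] by blast
  have "slopes (qpoly q B) = {g y / h y | y. y \<noteq> 0}"
  proof (intro equalityI subsetI)
    fix m assume "m \<in> slopes (qpoly q B)"
    then obtain x where x: "x \<noteq> 0" "m = qpoly q B x / x" by (auto simp: slopes_def)
    obtain y where y: "x = h y" using surj by (rule surjE)
    have "h 0 = 0" using q_ge_3 by (simp add: h_def f38_def power_0_left)
    then have "y \<noteq> 0" using x(1) y by auto
    then show "m \<in> {g y / h y | y. y \<noteq> 0}" using x(2) y by (auto simp: gB)
  next
    fix m assume "m \<in> {g y / h y | y. y \<noteq> 0}"
    then obtain y where "y \<noteq> 0" "m = qpoly q B (h y) / h y" by (auto simp: gB)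
    then show "m \<in> slopes (qpoly q B)" using h_nz by (auto simp: slopes_def)
  qed
  also have "\<dots> = slopes (qpoly q c)" unfolding eq g_def h_def ..
  finally have B: "B 0 = 0" "B 2 = 0" "B 6 = 0" "B 1 \<noteq> 0" "B 7 \<noteq> 0"
    using slopes_coefficients[OF _ c] by blast+
  have "qpoly q B (u * y + v * f38 q s \<delta> y) = w * y + z * f38 q s \<delta> y" for y
    using fun_cong[OF gB, of y] by (simp add: g_def h_def)
  from composition_trivial[OF this s N B]
  show False using nz[of 1] by simp
qed

section \<open>The iterates of psi\<close>

lemma psi8_power:
  "psi8 q x ^ (q ^ i) = (x ^ (q ^ (i + 1)) + x ^ (q ^ (i + 3)) - x ^ (q ^ (i + 5)) + x ^ (q ^ (i + 7))) / (2::'a)"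
proof -
  have p: "(y ^ q ^ m) ^ q ^ i = y ^ q ^ (i + m)" for y :: 'a and m i
    by (simp only: power_mult[symmetric] power_add[symmetric] add.commute)
  \<comment> \<open>All terms in the form \<open>\<plusminus> x ^ q ^ m\<close>, joined by \<open>+\<close>, so that Frobenius distributes over them.\<close>
  have "psi8 q x = (x ^ q ^ 1 + x ^ q ^ 3 + (- (x ^ q ^ 5)) + x ^ q ^ 7) / 2"
    by (simp add: psi8_def)
  then show ?thesis
    by (simp only: power_divide frobenius_add frobenius_minus frobenius_2 p) simp
qed

text \<open>
  On the eigenspaces of \<open>\<phi> ^ 4\<close> (where \<open>\<phi> x = x ^ q\<close>) for the eigenvalues \<open>1\<close> and \<open>-1\<close>, the map \<open>psi8 q\<close>
  coincides with \<open>\<phi> ^ 3\<close> and \<open>\<phi>\<close>; both have the square \<open>\<phi> ^ 2\<close> there.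
\<close>

lemma psi8_psi8: "psi8 q (psi8 q x) = (x ^ (q ^ 2) :: 'a)"
proof -
  have "psi8 q (psi8 q x) = (psi8 q x ^ (q ^ 1) + psi8 q x ^ (q ^ 3) - psi8 q x ^ (q ^ 5) + psi8 q x ^ (q ^ 7)) / 2"
    by (simp add: psi8_def[of q "psi8 q x"])
  also have "\<dots> = 2 * (2 * x ^ (q ^ 2)) / 2 / 2"
  proof -
    have x: "x ^ (q ^ 10) = x ^ (q ^ 2)" "x ^ (q ^ 12) = x ^ (q ^ 4)" "x ^ (q ^ 14) = x ^ (q ^ 6)"
      using frobenius_mod_8[of x 10] frobenius_mod_8[of x 12] frobenius_mod_8[of x 14] by simp_all
    show ?thesis
      unfolding psi8_power add_divide_distrib[symmetric] diff_divide_distrib[symmetric]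
      by (simp add: x power2_eq_square)
  qed
  also have "\<dots> = x ^ (q ^ 2)" using two_neq_0 by (simp only: nonzero_mult_div_cancel_left not_False_eq_True)
  finally show ?thesis .
qed

lemma psi8_iterate_qpoly:
  assumes "k \<in> {1, 3}"
  obtains c :: "nat \<Rightarrow> 'a" where "psi8 q ^^ k = qpoly q c"
    "c 0 = 0" "c 2 = 0" "c 6 = 0" "c 1 \<noteq> 0" "c 7 \<noteq> 0"
proof -
  have h: "inverse (2::'a) \<noteq> 0" using two_neq_0 by simp
  have half: "(A + B - C + D) / 2 = inverse 2 * A + inverse 2 * B - inverse 2 * C + inverse 2 * D"
    for A B C D :: 'a
    by (simp only: divide_inverse mult.commute[of _ "inverse 2"] distrib_left right_diff_distrib)
  consider "k = 1" | "k = 3" using assms by auto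
  then show thesis
  proof cases
    case 1
    let ?c = "\<lambda>i. if i \<in> {1, 3, 7} then inverse 2 else if i = 5 then - inverse 2 else (0::'a)"
    have "(psi8 q ^^ k) x = qpoly q ?c x" for x
      by (simp add: 1 psi8_def half qpoly_def sum_lessThan_8)
    then have eq: "psi8 q ^^ k = qpoly q ?c" by (rule ext)
    show thesis by (rule that[OF eq]) (use h in simp_all)
  next
    case 2
    let ?c = "\<lambda>i. if i \<in> {1, 3, 5} then inverse 2 else if i = 7 then - inverse 2 else (0::'a)"
    have "(psi8 q ^^ k) x = qpoly q ?c x" for x
    proof -
      have "(psi8 q ^^ k) x = psi8 q (psi8 q (psi8 q x))"
        by (simp only: 2 numeral_3_eq_3 funpow.simps comp_apply id_apply)
      also have "\<dots> = psi8 q x ^ (q ^ 2)" by (rule psi8_psi8)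
      also have "\<dots> = (x ^ (q ^ 3) + x ^ (q ^ 5) - x ^ (q ^ 7) + x ^ (q ^ 9)) / 2"
        by (subst psi8_power) simp
      also have "x ^ (q ^ 9) = x ^ q" using frobenius_mod_8[of x 9] by simp
      finally show ?thesis
        by (simp add: half qpoly_def sum_lessThan_8)
    qed
    then have eq: "psi8 q ^^ k = qpoly q ?c" by (rule ext)
    show thesis by (rule that[OF eq]) (use h in simp_all)
  qed
qed

end

section \<open>Reduction of semilinear equivalence to slopes\<close>

lemma field_automorphism_psi8:
  assumes "field_automorphism \<sigma>"
  shows "psi8 q (\<sigma> x) = \<sigma> (psi8 q x)"
proof -
  have bij: "bij \<sigma>" and add: "\<And>x y. \<sigma> (x + y) = \<sigma> x + \<sigma> y" and mult: "\<And>x y. \<sigma> (x * y) = \<sigma> x * \<sigma> y"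
    using assms by (auto simp: field_automorphism_def)
  have 0: "\<sigma> 0 = 0" by (metis add add_cancel_left_left)
  have inj0: "\<sigma> y = 0 \<longleftrightarrow> y = 0" for y using bij 0 by (metis bij_pointE)
  have 1: "\<sigma> 1 = 1" using mult[of 1 1] inj0[of 1] by simp
  have pow: "\<sigma> (y ^ n) = \<sigma> y ^ n" for y n by (induction n) (auto simp: 1 mult)
  have diff: "\<sigma> (y - z) = \<sigma> y - \<sigma> z" for y z using add[of "y - z" z] by simp
  have two: "\<sigma> 2 = 2" using add[of 1 1] by (simp add: 1)
  have half: "\<sigma> (y / 2) = \<sigma> y / 2" for y
  proof (cases "(2::'a) = 0")
    case True
    then show ?thesis by (simp only: True div_by_0 0)
  next
    case False
    have "\<sigma> (y / 2) * 2 = \<sigma> (y / 2 * 2)" by (simp only: mult two)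
    then show ?thesis using False by (simp add: nonzero_eq_divide_eq)
  qed
  show ?thesis by (simp add: psi8_def half add diff pow)
qed

lemma field_automorphism_psi8_iterate:
  assumes "field_automorphism \<sigma>"
  shows "(psi8 q ^^ k) (\<sigma> x) = \<sigma> ((psi8 q ^^ k) x)"
proof (induction k)
  case (Suc k)
  then show ?case by (simp only: funpow.simps comp_apply field_automorphism_psi8[OF assms])
qed simp

text \<open>
  The automorphism \<open>\<sigma>\<close> of an equivalence sends \<open>(x, F x)\<close> to \<open>(\<sigma> x, F (\<sigma> x))\<close>, so it only permutes the points of
  \<open>linset F\<close>, and the inverse \<open>M\<close> of its matrix sends \<open>linset f\<close> onto \<open>linset F\<close>; the numbers
  \<open>a\<close>, \<open>b\<close>, \<open>c\<close>, \<open>d\<close> are the entries of \<open>M\<close>. The denominators do not vanish because no point of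
  \<open>linset F\<close> has first coordinate \<open>0\<close>.
\<close>

lemma PGammaL_equivalent_slopes:
  fixes F f :: "'a::field \<Rightarrow> 'a"
  assumes equiv: "PGammaL_equivalent (linset F) (linset f)"
    and comm: "\<And>\<sigma> x. field_automorphism \<sigma> \<Longrightarrow> F (\<sigma> x) = \<sigma> (F x)"
  shows "\<exists>a b c d. (\<forall>y. y \<noteq> 0 \<longrightarrow> a * y + b * f y \<noteq> 0) \<and>
    slopes F = {(c * y + d * f y) / (a * y + b * f y) | y. y \<noteq> 0}"
proof -
  define P where "P x = (vector [x, F x] :: 'a ^ 2)" for x
  define Q where "Q y = (vector [y, f y] :: 'a ^ 2)" for y
  obtain A :: "'a ^ 2 ^ 2" and \<sigma> where A: "invertible A" and \<sigma>: "field_automorphism \<sigma>"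
    and img: "restrict ((`) (\<lambda>v. A *v (\<chi> i. \<sigma> (v $ i)))) PG1 ` linset F = linset f"
    using equiv unfolding PGammaL_equivalent_def PGammaL2_def GammaL2_def by blast
  define g where "g v = A *v (\<chi> i. \<sigma> (v $ i))" for v
  obtain M where M: "M ** A = mat 1" "A ** M = mat 1" using A by (auto simp: invertible_def)
  have MA: "M *v (A *v v) = v" for v by (simp add: matrix_vector_mul_assoc M)
  have AM: "A *v (M *v v) = v" for v by (simp add: matrix_vector_mul_assoc M)
  have bij: "bij \<sigma>" and mult: "\<And>x y. \<sigma> (x * y) = \<sigma> x * \<sigma> y"
    and add: "\<And>x y. \<sigma> (x + y) = \<sigma> x + \<sigma> y"
    using \<sigma> by (auto simp: field_automorphism_def)
  have "\<sigma> 0 = 0" by (metis add add_cancel_left_left)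
  then have \<sigma>0: "\<sigma> x = 0 \<longleftrightarrow> x = 0" for x using bij by (metis bij_pointE)
  have linF: "linset F = {vec.span {P x} | x. x \<noteq> 0}" and linf: "linset f = {vec.span {Q x} | x. x \<noteq> 0}"
    by (simp_all add: linset_def P_def Q_def)
  have P0: "P x \<noteq> 0" and Q0: "Q x \<noteq> 0" if "x \<noteq> 0" for x
    using that by (metis P_def vector_2(1) zero_index, metis Q_def vector_2(1) zero_index)
  have g_P: "g (t *s P x) = \<sigma> t *s (A *v P (\<sigma> x))" for t x
  proof -
    have "(\<chi> i. \<sigma> ((t *s P x) $ i)) = \<sigma> t *s P (\<sigma> x)"
      by (simp add: vec_eq_iff forall_2 P_def mult comm[OF \<sigma>])
    then show ?thesis by (simp add: g_def vector_scalar_commute vec.scale)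
  qed
  have img': "(\<lambda>L. g ` L) ` linset F = linset f"
  proof -
    have "linset F \<subseteq> PG1" using P0 by (auto simp: linF PG1_def)
    then have "restrict ((`) g) PG1 ` linset F = (\<lambda>L. g ` L) ` linset F"
      by (intro image_cong refl) auto
    then show ?thesis using img unfolding g_def by simp
  qed
  have 1: "\<exists>y t. y \<noteq> 0 \<and> P x = t *s (M *v Q y)" if x: "x \<noteq> 0" for x
  proof -
    obtain x' where x': "x = \<sigma> x'" using bij by (metis bij_pointE)
    then have "x' \<noteq> 0" using x \<sigma>0 by auto
    then have "g ` vec.span {P x'} \<in> linset f" using img' by (auto simp: linF)
    then obtain y where y: "y \<noteq> 0" "g ` vec.span {P x'} = vec.span {Q y}" by (auto simp: linf)
    have "P x' \<in> vec.span {P x'}" by (simp add: vec.span_base)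
    then have "g (P x') \<in> vec.span {Q y}" using y by blast
    then obtain t where "g (P x') = t *s Q y" by (auto simp: vec.span_singleton)
    moreover have "g (P x') = A *v P x" 
    proof -
      have "(\<chi> i. \<sigma> (P x' $ i)) = P x"
        by (simp add: vec_eq_iff forall_2 P_def x' comm[OF \<sigma>])
      then show ?thesis by (simp add: g_def)
    qed
    ultimately have "P x = M *v (t *s Q y)" using MA by metis
    then show ?thesis using y by (auto simp: vec.scale)
  qed
  have 2: "\<exists>x t. x \<noteq> 0 \<and> M *v Q y = t *s P x" if y: "y \<noteq> 0" for y
  proof -
    have "vec.span {Q y} \<in> (\<lambda>L. g ` L) ` linset F" using y by (auto simp: img' linf)
    then obtain x where x: "x \<noteq> 0" "vec.span {Q y} = g ` vec.span {P x}" by (auto simp: linF)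
    have "Q y \<in> vec.span {Q y}" by (simp add: vec.span_base)
    then obtain t where "Q y = g (t *s P x)" using x by (auto simp: vec.span_singleton)
    then have "M *v Q y = \<sigma> t *s P (\<sigma> x)" by (simp add: g_P vec.scale MA)
    then show ?thesis using x \<sigma>0 by blast
  qed
  have comp: "(M *v Q y) $ 1 = M $ 1 $ 1 * y + M $ 1 $ 2 * f y"
    "(M *v Q y) $ 2 = M $ 2 $ 1 * y + M $ 2 $ 2 * f y" for y
    by (simp_all add: matrix_vector_mult_def sum_2 Q_def)
  have P12: "P x $ 1 = x" "P x $ 2 = F x" for x by (simp_all add: P_def)
  have nz: "(M *v Q y) $ 1 \<noteq> 0" if y: "y \<noteq> 0" for y
  proof
    assume 0: "(M *v Q y) $ 1 = 0"
    obtain x t where "x \<noteq> 0" "M *v Q y = t *s P x" using 2[OF y] by blast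
    then have "M *v Q y = 0" using 0 by (auto simp: P12)
    then have "Q y = 0" using AM[of "Q y"] by simp
    then show False using Q0[OF y] by simp
  qed
  have "slopes F = {(M *v Q y) $ 2 / (M *v Q y) $ 1 | y. y \<noteq> 0}"
  proof (intro equalityI subsetI)
    fix m assume "m \<in> slopes F"
    then obtain x where x: "x \<noteq> 0" "m = F x / x" by (auto simp: slopes_def)
    obtain y t where y: "y \<noteq> 0" "P x = t *s (M *v Q y)" using 1[OF x(1)] by blast
    then have "x = t * (M *v Q y) $ 1" "F x = t * (M *v Q y) $ 2"
      using P12[of x] by (simp_all add: y(2))
    then have "m = (M *v Q y) $ 2 / (M *v Q y) $ 1" using x by auto
    then show "m \<in> {(M *v Q y) $ 2 / (M *v Q y) $ 1 | y. y \<noteq> 0}" using y by blast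
  next
    fix m assume "m \<in> {(M *v Q y) $ 2 / (M *v Q y) $ 1 | y. y \<noteq> 0}"
    then obtain y where y: "y \<noteq> 0" "m = (M *v Q y) $ 2 / (M *v Q y) $ 1" by blast
    obtain x t where x: "x \<noteq> 0" "M *v Q y = t *s P x" using 2[OF y(1)] by blast
    have "t \<noteq> 0" using nz[OF y(1)] x by auto
    then have "m = F x / x" using x y by (simp add: P12)
    then show "m \<in> slopes F" using x by (auto simp: slopes_def)
  qed
  then show ?thesis using nz unfolding comp by blast
qed

theorem proposition3p6:
  fixes q k s :: nat and \<delta> :: "'a::{field, finite}"
  assumes "primepow q" and "odd q" and "CARD('a) = q ^ 8"
    and "k \<in> {1, 3}"
    and "admissible q s \<delta>"
  shows "\<not> PGammaL_equivalent (linset (psi8 q ^^ k :: 'a \<Rightarrow> 'a)) (linset (f38 q s \<delta>))"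
proof
  assume equiv: "PGammaL_equivalent (linset (psi8 q ^^ k :: 'a \<Rightarrow> 'a)) (linset (f38 q s \<delta>))"
  interpret octic_field q "TYPE('a)"
    using assms(1-3) by unfold_locales
  have s: "odd s"
  proof
    assume "even s"
    then have "2 dvd gcd s 4" by simp
    moreover have "gcd s 4 = 1" using assms(5) by (simp add: admissible_def)
    ultimately show False by simp
  qed
  have N: "\<delta> ^ (q ^ 4 + 1) \<noteq> 1" using assms(5) by (simp add: admissible_def)
  obtain c :: "nat \<Rightarrow> 'a" where c: "psi8 q ^^ k = qpoly q c"
    "c 0 = 0" "c 2 = 0" "c 6 = 0" "c 1 \<noteq> 0" "c 7 \<noteq> 0"
    by (rule psi8_iterate_qpoly[OF assms(4)])
  have "\<exists>u v w z. (\<forall>y. y \<noteq> 0 \<longrightarrow> u * y + v * f38 q s \<delta> y \<noteq> 0) \<and>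
      slopes (psi8 q ^^ k) = {(w * y + z * f38 q s \<delta> y) / (u * y + v * f38 q s \<delta> y) | y. y \<noteq> 0}"
    by (rule PGammaL_equivalent_slopes[OF equiv field_automorphism_psi8_iterate])
  then obtain u v w z where
    nz: "\<forall>y. y \<noteq> 0 \<longrightarrow> u * y + v * f38 q s \<delta> y \<noteq> 0"
    and eq: "slopes (psi8 q ^^ k) = {(w * y + z * f38 q s \<delta> y) / (u * y + v * f38 q s \<delta> y) | y. y \<noteq> 0}"
    by (elim exE conjE)
  have h_nz: "u * y + v * f38 q s \<delta> y \<noteq> 0" if "y \<noteq> 0" for y
    using nz that by simp
  show False
    using slopes_not_projectively_f38[OF c(2-6) s N h_nz] eq unfolding c(1) by (rule notE)
qed

end
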